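(* For all positive integers $m\le n$, the double path $\overrightarrow{P}_{n,[m]}$ (vertex set $[n]=\{1,\dots,n\}$, loops exactly at the vertices $1,\dots,m$) requires the nSSP.
   Context: A digraph $G$ has vertex set $V(G)=[n]$ and arc set $E(G)\subseteq [n]\times[n]$; arcs $(v,v)$ are loops. $\mathcal M(G)$ is the set of real $n\times n$ matrices $A=(a_{ij})$ with $a_{ij}\neq 0$ if and only if $(i,j)\in E(G)$. A real $n\times n$ matrix $A$ has the non-symmetric Strong Spectral Property (nSSP) if the only real matrix $X$ with $A\circ X=O$ (entrywise product) and $AX^\top-X^\top A=O$ is $X=O$. A digraph $G$ requires the nSSP if every $A\in\mathcal M(G)$ has the nSSP, and allows the nSSP if some $A\in\mathcal M(G)$ has it. For $\mathcal L\subseteq[n]$, the double path $\overrightarrow{P}_{n,\mathcal L}$ has vertex set $[n]$ and arc set $\{(i,i+1),(i+1,i): i\in[n-1]\}\cup\{(\ell,\ell):\ell\in\mathcal L\}$ (so $\mathcal M(\overrightarrow{P}_{n,\mathcal L})$ consists of irreducible tridiagonal matrices whose nonzero diagonal entries are exactly in positions $\mathcal L$). *)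

theory Defs
  imports
    Complex_Main
    "Graph_Theory.Pair_Digraph"
    "Jordan_Normal_Form.Matrix"
begin

text \<open>
  Digraphs (loops allowed, no parallel arcs) are values of \<^type>\<open>pair_pre_digraph\<close> whose vertex
  set is \<open>{1..n}\<close>. The rows and columns of a matrix of type \<^type>\<open>mat\<close> are numbered from 0, so
  vertex \<open>i\<close> corresponds to row and column \<open>i - 1\<close>.
\<close>

definition matrices_of :: "nat pair_pre_digraph \<Rightarrow> real mat set" where
  "matrices_of G =
    {A \<in> carrier_mat (card (pverts G)) (card (pverts G)).
      \<forall>i\<in>pverts G. \<forall>j\<in>pverts G. A $$ (i - 1, j - 1) \<noteq> 0 \<longleftrightarrow> (i, j) \<in> parcs G}"

definition hadamard_prod :: "'a::times mat \<Rightarrow> 'a mat \<Rightarrow> 'a mat" where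
  "hadamard_prod A B = mat (dim_row A) (dim_col A) (\<lambda>(i, j). A $$ (i, j) * B $$ (i, j))"

definition nSSP :: "real mat \<Rightarrow> bool" where
  "nSSP A \<longleftrightarrow> square_mat A \<and>
    (\<forall>X \<in> carrier_mat (dim_row A) (dim_row A).
      hadamard_prod A X = 0\<^sub>m (dim_row A) (dim_row A) \<and>
      A * transpose_mat X - transpose_mat X * A = 0\<^sub>m (dim_row A) (dim_row A)
      \<longrightarrow> X = 0\<^sub>m (dim_row A) (dim_row A))"

definition requires_nSSP :: "nat pair_pre_digraph \<Rightarrow> bool" where
  "requires_nSSP G \<longleftrightarrow> (\<forall>A \<in> matrices_of G. nSSP A)"

definition double_path :: "nat \<Rightarrow> nat set \<Rightarrow> nat pair_pre_digraph" where
  "double_path n L =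
    \<lparr> pverts = {1..n},
      parcs = {(i, i + 1) | i. 1 \<le> i \<and> i < n} \<union> {(i + 1, i) | i. 1 \<le> i \<and> i < n}
              \<union> {(l, l) | l. l \<in> L} \<rparr>"

lemma pair_wf_digraph_double_path:
  assumes "L \<subseteq> {1..n}"
  shows "pair_wf_digraph (double_path n L)"
  using assms by unfold_locales (auto simp: double_path_def)

end

theory Submission
  imports Defs
begin

text \<open>
  Let \<open>Y = X\<^sup>T\<close>, which commutes with \<open>A\<close> and vanishes on both off-diagonals and at the diagonal
  positions \<open>1, \<dots>, m\<close>. Entry \<open>(i, j)\<close> of \<open>A Y = Y A\<close> relates \<open>Y\<close> at \<open>(i, j)\<close> and its four
  neighbours. If \<open>Y\<close> vanishes above the diagonal on all antidiagonals up to the one of \<open>(i, j)\<close>,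
  this says that \<open>(i + 1, j)\<close> and \<open>(i, j + 1)\<close> vanish together, so the next antidiagonal vanishes as
  soon as one of its entries does. Antidiagonals through \<open>(c, c + 1)\<close>, and through \<open>(c, c)\<close> with
  \<open>c \<le> m\<close>, contain a zero by hypothesis. For \<open>c > m\<close>, either the antidiagonal of \<open>(c, c)\<close> leaves the
  matrix through its last column below row \<open>m\<close>, where the neighbour is missing, or it meets row
  \<open>m\<close> at \<open>(m, 2c - m)\<close>. In the latter case, \<open>A\<close> has no diagonal beyond \<open>m\<close>, so \<open>Y\<close> vanishes on the
  odd diagonals in rows \<open>\<ge> m\<close>, and the equation at \<open>(m, 2c - m)\<close> reduces to
  \<open>a\<^sub>m\<^sub>m y\<^sub>m\<^sub>,\<^sub>2\<^sub>c\<^sub>-\<^sub>m = 0\<close>.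
\<close>

text \<open>Padding \<open>y\<close> with zeros keeps \<open>commute\<close> in one form at the
  border: a missing neighbour contributes 0.\<close>

locale tridiagonal_commuting =
  fixes n m :: nat and a y :: "nat \<Rightarrow> nat \<Rightarrow> real"
  assumes m_pos: "1 \<le> m"
    and super_nonzero: "\<And>i. 1 \<le> i \<Longrightarrow> i < n \<Longrightarrow> a i (Suc i) \<noteq> 0"
    and sub_nonzero: "\<And>i. 1 \<le> i \<Longrightarrow> i < n \<Longrightarrow> a (Suc i) i \<noteq> 0"
    and diag_nonzero: "\<And>i. 1 \<le> i \<Longrightarrow> i \<le> m \<Longrightarrow> a i i \<noteq> 0"
    and diag_zero: "\<And>i. m < i \<Longrightarrow> a i i = 0"
    and y_outside: "\<And>i j. i = 0 \<or> j = 0 \<or> n < i \<or> n < j \<Longrightarrow> y i j = 0"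
    and y_super: "\<And>i. y i (Suc i) = 0"
    and y_sub: "\<And>i. y (Suc i) i = 0"
    and y_diag: "\<And>i. i \<le> m \<Longrightarrow> y i i = 0"
    and commute: "\<And>i j. 1 \<le> i \<Longrightarrow> i \<le> n \<Longrightarrow> 1 \<le> j \<Longrightarrow> j \<le> n \<Longrightarrow>
      a i (i - 1) * y (i - 1) j + a i i * y i j + a i (Suc i) * y (Suc i) j =
      y i (j - 1) * a (j - 1) j + y i j * a j j + y i (Suc j) * a (Suc j) j"
begin

text \<open>Solve the equation at \<open>(Suc i, j)\<close> for \<open>y i j\<close>: both diagonal
  terms drop out since \<open>Suc i\<close> and \<open>j\<close> exceed \<open>m\<close>. The other
  neighbours are again on odd diagonals, closer to the main one or further down the same one, so the
  measure decreases.\<close>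

lemma odd_diagonal_zero:
  assumes "m \<le> i" "i < j" "odd (j - i)"
  shows "y i j = 0"
  using assms
proof (induction "(j - i) + (n - i)" arbitrary: i j rule: less_induct)
  case less
  show ?case
  proof (cases "j > n \<or> j = Suc i")
    case True
    then show ?thesis using y_outside y_super by auto
  next
    case False
    \<comment> \<open>Parity gives the gap of 3 that keeps \<open>(i + 2, j)\<close> and
      \<open>(i + 1, j - 1)\<close> strictly above the diagonal.\<close>
    moreover have "j \<noteq> i + 2"
      using less.prems by auto
    ultimately have b: "j \<le> n" "j \<ge> i + 3"
      using less.prems by auto
    have 1: "y (Suc (Suc i)) j = 0"
      by (rule less.hyps) (use less.prems b in auto)
    have 2: "y (Suc i) (j - 1) = 0"
      by (rule less.hyps) (use less.prems b in auto)
    have 3: "y (Suc i) (Suc j) = 0"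
      by (rule less.hyps) (use less.prems b in auto)
    have "a (Suc i) i * y i j = 0"
      using commute[of "Suc i" j] 1 2 3 less.prems b diag_zero by simp
    moreover have "a (Suc i) i \<noteq> 0"
      using sub_nonzero less.prems b m_pos by simp
    ultimately show ?thesis by simp
  qed
qed

lemma antidiagonal_step:
  assumes zero: "\<And>p q. p \<le> q \<Longrightarrow> p + q \<le> i + j \<Longrightarrow> y p q = 0"
    and "1 \<le> i" "i < j" "j \<le> n"
  shows "y (Suc i) j = 0 \<longleftrightarrow> y i (Suc j) = 0"
proof -
  have "a i (Suc i) * y (Suc i) j = y i (Suc j) * a (Suc j) j"
    using commute[of i j] zero[of "i - 1" j] zero[of i j] zero[of i "j - 1"] assms(2-) by simp
  moreover have "a i (Suc i) \<noteq> 0" "j < n \<Longrightarrow> a (Suc j) j \<noteq> 0"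
    using super_nonzero sub_nonzero assms(2-) by auto
  \<comment> \<open>In the last column no nonzero coefficient is available on the right; the padding
    makes that side vanish.\<close>
  moreover have "j = n \<Longrightarrow> y i (Suc j) = 0"
    using y_outside by simp
  ultimately show ?thesis using \<open>j \<le> n\<close> by fastforce
qed

text \<open>Iterates \<open>antidiagonal_step\<close> outwards. The bound \<open>Suc n\<close> lets
  the walk end one column outside the matrix, where \<open>y\<close> is known to be 0.\<close>

lemma antidiagonal_iff:
  assumes zero: "\<And>p q. p \<le> q \<Longrightarrow> p + q < i + j \<Longrightarrow> y p q = 0"
    and "i \<le> j" "k < i" "j + k \<le> Suc n"
  shows "y i j = 0 \<longleftrightarrow> y (i - k) (j + k) = 0"
  using assms(3,4)
proof (induction k)
  case (Suc k)
  have "y (Suc (i - Suc k)) (j + k) = 0 \<longleftrightarrow> y (i - Suc k) (Suc (j + k)) = 0"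
    by (rule antidiagonal_step) (use Suc.prems \<open>i \<le> j\<close> zero in auto)
  moreover have "Suc (i - Suc k) = i - k" using Suc.prems by simp
  ultimately show ?case using Suc by simp
qed simp

lemma diagonal_step:
  assumes zero: "\<And>p q. p \<le> q \<Longrightarrow> p + q < 2 * c \<Longrightarrow> y p q = 0"
  shows "y c c = 0"
proof (cases "c \<le> m \<or> n < c")
  case True
  then show ?thesis using y_diag y_outside by auto
next
  case False
  then have c: "m < c" "c \<le> n" by auto
  show ?thesis
  proof (cases "2 * c - m \<le> n")
    case True
    have "y (Suc m) (2 * c - m) = 0" "y m (2 * c - m - 1) = 0" "y m (Suc (2 * c - m)) = 0"
      by (rule odd_diagonal_zero; use c in \<open>simp; presburger\<close>)+
    \<comment> \<open>This neighbour is above row \<open>m\<close>, out of reach of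
      \<open>odd_diagonal_zero\<close>, but on an earlier antidiagonal.\<close>
    moreover have "y (m - 1) (2 * c - m) = 0"
      by (rule zero) (use c m_pos in auto)
    ultimately have "a m m * y m (2 * c - m) = 0"
      using commute[of m "2 * c - m"] c m_pos True diag_zero[of "2 * c - m"] by simp
    then have "y m (2 * c - m) = 0"
      using diag_nonzero[of m] m_pos by simp
    moreover have "y c c = 0 \<longleftrightarrow> y (c - (c - m)) (c + (c - m)) = 0"
      by (rule antidiagonal_iff) (use zero c m_pos True in auto)
    moreover have "c - (c - m) = m" "c + (c - m) = 2 * c - m" using c by auto
    ultimately show ?thesis by simp
  next
    case False
    \<comment> \<open>The walk stops in column \<open>n + 1\<close>, at row
      \<open>2 * c - n - 1\<close>, which is at least \<open>m\<close> and hence positive.\<close>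
    have "y c c = 0 \<longleftrightarrow> y (c - (Suc n - c)) (c + (Suc n - c)) = 0"
      by (rule antidiagonal_iff) (use zero c m_pos False in auto)
    then show ?thesis using y_outside c by simp
  qed
qed

lemma antidiagonal_zero:
  assumes zero: "\<And>p q. p \<le> q \<Longrightarrow> p + q < r + s \<Longrightarrow> y p q = 0"
    and "y r s = 0" "r \<le> s" "i \<le> r" "i + j = r + s"
  shows "y i j = 0"
proof (cases "i = 0 \<or> n < j")
  case True
  then show ?thesis using y_outside by auto
next
  case False
  have "y r s = 0 \<longleftrightarrow> y (r - (r - i)) (s + (r - i)) = 0"
    by (rule antidiagonal_iff) (use zero assms(3-) False in auto)
  moreover have "r - (r - i) = i" "s + (r - i) = j"
    using assms(4,5) by auto
  ultimately show ?thesis using \<open>y r s = 0\<close> by simp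
qed

text \<open>Induction over antidiagonals. Each is started at its innermost entry, on the diagonal or
  superdiagonal by parity, so that an outward walk reaches all of its upper half.\<close>

lemma upper_zero: "i \<le> j \<Longrightarrow> y i j = 0"
proof (induction "i + j" arbitrary: i j rule: less_induct)
  case less
  let ?c = "(i + j) div 2"
  have zero: "y p q = 0" if "p \<le> q" "p + q < i + j" for p q
    using less.hyps that by simp
  show ?case
  proof (cases "even (i + j)")
    case True
    then have e: "2 * ?c = i + j" by simp
    have "y ?c ?c = 0"
      by (rule diagonal_step) (use zero e in auto)
    show ?thesis
      by (rule antidiagonal_zero[OF _ \<open>y ?c ?c = 0\<close>]) (use zero e less.prems in auto)
  next
    case False
    then have e: "?c + Suc ?c = i + j" by presburger
    show ?thesis
      by (rule antidiagonal_zero[OF _ y_super[of ?c]]) (use zero e less.prems in auto)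
  qed
qed

text \<open>Transposing swaps the two sides of \<open>commute\<close>; this carries
  \<open>upper_zero\<close> over to the lower triangle.\<close>

lemma tridiagonal_commuting_transpose: "tridiagonal_commuting n m (\<lambda>i j. a j i) (\<lambda>i j. y j i)"
proof
  fix i j assume "1 \<le> i" "i \<le> n" "1 \<le> j" "j \<le> n"
  then show "a (i - 1) i * y j (i - 1) + a i i * y j i + a (Suc i) i * y j (Suc i) =
      y (j - 1) i * a j (j - 1) + y j i * a j j + y (Suc j) i * a j (Suc j)"
    using commute[of j i] by (simp add: mult.commute)
qed (use m_pos super_nonzero sub_nonzero diag_nonzero diag_zero y_outside y_super y_sub y_diag in auto)

lemma all_zero: "y i j = 0"
  using upper_zero tridiagonal_commuting.upper_zero[OF tridiagonal_commuting_transpose]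
  by (cases "i \<le> j") auto

end

lemma sum_three_terms:
  fixes f :: "nat \<Rightarrow> real"
  assumes "1 \<le> i" and "\<And>k. k = 0 \<or> n < k \<Longrightarrow> f k = 0"
    and "\<And>k. k \<noteq> i \<Longrightarrow> Suc k \<noteq> i \<Longrightarrow> k \<noteq> Suc i \<Longrightarrow> f k = 0"
  shows "sum f {1..n} = f (i - 1) + f i + f (Suc i)"
proof -
  have "sum f {1..n} = sum f {i - 1, i, Suc i}"
    by (rule sum.mono_neutral_cong) (use assms in \<open>auto simp: not_le\<close>)
  also have "\<dots> = f (i - 1) + f i + f (Suc i)"
    using assms(1) by (cases i) auto
  finally show ?thesis .
qed

lemma mult_entry:
  assumes "A \<in> carrier_mat n n" "B \<in> carrier_mat n n" "i \<in> {1..n}" "j \<in> {1..n}"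
  shows "(A * B) $$ (i - 1, j - 1) =
    (\<Sum>k\<in>{1..n}. A $$ (i - 1, k - 1) * B $$ (k - 1, j - 1) :: real)"
proof -
  have "(A * B) $$ (i - 1, j - 1) = (\<Sum>k<n. A $$ (i - 1, k) * B $$ (k, j - 1))"
    using assms by (auto simp: scalar_prod_def lessThan_atLeast0 intro!: sum.cong)
  then show ?thesis by (simp add: sum.atLeast1_atMost_eq)
qed

theorem theorem5p5:
  fixes m n :: nat
  assumes "1 \<le> m" and "m \<le> n"
  shows "requires_nSSP (double_path n {1..m})"
  unfolding requires_nSSP_def nSSP_def
proof (intro ballI conjI impI)
  fix A assume "A \<in> matrices_of (double_path n {1..m})"
  then have A: "A \<in> carrier_mat n n"
    and A_iff: "\<And>i j. i \<in> {1..n} \<Longrightarrow> j \<in> {1..n} \<Longrightarrow>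
      A $$ (i - 1, j - 1) \<noteq> 0 \<longleftrightarrow> (i, j) \<in> parcs (double_path n {1..m})"
    by (auto simp: matrices_of_def double_path_def)
  then show "square_mat A" by auto
  fix X assume X: "X \<in> carrier_mat (dim_row A) (dim_row A)"
    and H: "hadamard_prod A X = 0\<^sub>m (dim_row A) (dim_row A) \<and>
      A * transpose_mat X - transpose_mat X * A = 0\<^sub>m (dim_row A) (dim_row A)"
  have Xn: "X \<in> carrier_mat n n" and Y: "transpose_mat X \<in> carrier_mat n n" using A X by auto
  \<comment> \<open>Without the guards, index 0 would be truncated to matrix index 0 and alias index
    1.\<close>
  define a where "a i j = (if i \<in> {1..n} \<and> j \<in> {1..n} then A $$ (i - 1, j - 1) else 0)" for i j
  define y where "y i j = (if i \<in> {1..n} \<and> j \<in> {1..n} then X $$ (j - 1, i - 1) else 0)" for i j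
  have a_iff: "a i j \<noteq> 0 \<longleftrightarrow> i \<in> {1..n} \<and> j \<in> {1..n} \<and> (j = Suc i \<or> i = Suc j \<or> i = j \<and> i \<le> m)" for i j
    using A_iff[of i j] by (auto simp: a_def double_path_def)
  have ay: "a i j \<noteq> 0 \<Longrightarrow> y j i = 0" for i j
  proof -
    assume nz: "a i j \<noteq> 0"
    then have r: "i \<in> {1..n}" "j \<in> {1..n}" by (auto simp: a_iff)
    have "hadamard_prod A X $$ (i - 1, j - 1) = A $$ (i - 1, j - 1) * X $$ (i - 1, j - 1)"
      using A r by (auto simp: hadamard_prod_def)
    moreover have "hadamard_prod A X $$ (i - 1, j - 1) = 0"
      using H A r by auto
    ultimately show ?thesis using nz r by (auto simp: a_def y_def)
  qed
  have comm: "(\<Sum>k\<in>{1..n}. a i k * y k j) = (\<Sum>k\<in>{1..n}. y i k * a k j)"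
    if r: "i \<in> {1..n}" "j \<in> {1..n}" for i j
  proof -
    have "(A * transpose_mat X - transpose_mat X * A) $$ (i - 1, j - 1) = 0"
      using H A r by auto
    then have "(A * transpose_mat X) $$ (i - 1, j - 1) = (transpose_mat X * A) $$ (i - 1, j - 1)"
      using A Xn r by auto
    then have "(\<Sum>k\<in>{1..n}. A $$ (i - 1, k - 1) * transpose_mat X $$ (k - 1, j - 1)) =
        (\<Sum>k\<in>{1..n}. transpose_mat X $$ (i - 1, k - 1) * A $$ (k - 1, j - 1))"
      using mult_entry[OF A Y r] mult_entry[OF Y A r] by simp
    moreover have "A $$ (i - 1, k - 1) * transpose_mat X $$ (k - 1, j - 1) = a i k * y k j"
      "transpose_mat X $$ (i - 1, k - 1) * A $$ (k - 1, j - 1) = y i k * a k j"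
      if "k \<in> {1..n}" for k
      using that r Xn by (auto simp: a_def y_def)
    ultimately show ?thesis by simp
  qed
  have a_zero: "a i k = 0" if "k \<noteq> i" "Suc k \<noteq> i" "k \<noteq> Suc i" for i k
    using a_iff[of i k] that by blast
  have y_zero: "y i j = 0" if "i = 0 \<or> j = 0 \<or> n < i \<or> n < j" for i j
    using that by (auto simp: y_def)
  interpret tridiagonal_commuting n m a y
  proof
    show "1 \<le> m" by fact
  next
    fix i j assume r: "1 \<le> i" "i \<le> n" "1 \<le> j" "j \<le> n"
    have "(\<Sum>k\<in>{1..n}. a i k * y k j) =
        a i (i - 1) * y (i - 1) j + a i i * y i j + a i (Suc i) * y (Suc i) j"
      by (rule sum_three_terms) (use r a_zero y_zero in auto)
    moreover have "(\<Sum>k\<in>{1..n}. y i k * a k j) =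
        y i (j - 1) * a (j - 1) j + y i j * a j j + y i (Suc j) * a (Suc j) j"
      by (rule sum_three_terms) (use r a_zero[of j] a_zero y_zero in auto)
    ultimately show "a i (i - 1) * y (i - 1) j + a i i * y i j + a i (Suc i) * y (Suc i) j =
        y i (j - 1) * a (j - 1) j + y i j * a j j + y i (Suc j) * a (Suc j) j"
      using comm[of i j] r by simp
  next
    fix i
    \<comment> \<open>Inside the matrix \<open>a\<close> is nonzero at the transposed position, so
      \<open>ay\<close> applies; outside, the padding does.\<close>
    show "y i (Suc i) = 0" "y (Suc i) i = 0"
      using ay[of "Suc i" i] ay[of i "Suc i"] a_iff[of "Suc i" i] a_iff[of i "Suc i"]
      by (auto simp: y_def)
    show "y i i = 0" if "i \<le> m"
      using ay[of i i] a_iff[of i i] that by (auto simp: y_def)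
    show "a i (Suc i) \<noteq> 0" "a (Suc i) i \<noteq> 0" if "1 \<le> i" "i < n"
      using that a_iff[of i "Suc i"] a_iff[of "Suc i" i] by auto
    show "a i i \<noteq> 0" if "1 \<le> i" "i \<le> m"
      using that a_iff[of i i] assms by auto
    show "a i i = 0" if "m < i"
      using that a_iff[of i i] by auto
  qed (rule y_zero)
  show "X = 0\<^sub>m (dim_row A) (dim_row A)"
  proof (rule eq_matI)
    fix i j assume "i < dim_row (0\<^sub>m (dim_row A) (dim_row A) :: real mat)"
      "j < dim_col (0\<^sub>m (dim_row A) (dim_row A) :: real mat)"
    then have "i < n" "j < n" using A by auto
    then show "X $$ (i, j) = 0\<^sub>m (dim_row A) (dim_row A) $$ (i, j)"
      using all_zero[of "Suc j" "Suc i"] A by (auto simp: y_def)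
  qed (use X in auto)
qed

end
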